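(* Let $X\in\mathbb{R}^{n_1\times h}$ be a matrix and let $\mathcal{X}\in\mathbb{R}^{n_1\times n_2\times n_3}$ be the third order tensor obtained by reshaping $X$ (zero-padding columns if necessary and cutting into $n_3$ consecutive column blocks of width $n_2$, as specified in the context). Then $$\operatorname{rank}_t(\mathcal{X}) \le \operatorname{rank}(X) \le n_3 \operatorname{rank}_t(\mathcal{X}),$$ $$\operatorname{rank}(X) \le \left\|\operatorname{rank}_m(\mathcal{X})\right\|_1 \le n_3 \operatorname{rank}(X).$$
   Context: Reshaping: for a given positive integer $n_2$, append a zero matrix $0\in\mathbb{R}^{n_1\times l}$ to $X$, with the smallest $l\ge 0$ such that $n_3 := (h+l)/n_2$ is an integer, so that $X := [X,0]\in\mathbb{R}^{n_1\times(h+l)}$. Then $\mathcal{X}\in\mathbb{R}^{n_1\times n_2\times n_3}$ is the tensor whose $k$-th frontal slice $X^{(k)}=\mathcal{X}(:,:,k)$ is $X^{(k)} = X(:,(k-1)n_2+1:kn_2)$ for $k=1,\dots,n_3$. DFT: let $\omega = e^{-2\pi \mathfrak{b}/n_3}$ with $\mathfrak{b}=\sqrt{-1}$ and let $F_{n_3}\in\mathbb{C}^{n_3\times n_3}$ be the matrix with $(a,b)$ entry $\omega^{(a-1)(b-1)}$. For $\mathcal{X}\in\mathbb{R}^{n_1\times n_2\times n_3}$, $\bar{\mathcal{X}}\in\mathbb{C}^{n_1\times n_2\times n_3}$ is defined by $\bar{\mathcal{X}}(i,j,:) = F_{n_3}\mathcal{X}(i,j,:)$, and $\bar X^{(k)}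 = \bar{\mathcal{X}}(:,:,k)$ is its $k$-th frontal slice. Tensor multi-rank and tubal rank: with $r_k = \operatorname{rank}(\bar X^{(k)})$, $\operatorname{rank}_m(\mathcal{X}) = (r_1,\dots,r_{n_3})$ and $\operatorname{rank}_t(\mathcal{X}) = \max\{r_k : k=1,\dots,n_3\}$. Here $\|\cdot\|_1$ is the $\ell_1$ norm of a vector. *)

theory Defs
  imports Complex_Main "Jordan_Normal_Form.DL_Rank"
begin

text \<open>All indices (rows, columns, tensor positions, frontal slices) are 0-based, as in the
  matrix library; the 1-based index \<open>k\<close> of the mathematical text is \<open>k - 1\<close> here.\<close>

definition mat_rank :: "'a::field mat \<Rightarrow> nat" where
  "mat_rank A = vec_space.rank (dim_row A) A"

text \<open>Only the values of \<open>tensor_entry\<close> at positions inside the dimensions are meaningful.\<close>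

datatype 'a tensor3 =
  Tensor3 (tensor_dim1: nat) (tensor_dim2: nat) (tensor_dim3: nat)
    (tensor_entry: "nat \<Rightarrow> nat \<Rightarrow> nat \<Rightarrow> 'a")

definition frontal_slice :: "'a tensor3 \<Rightarrow> nat \<Rightarrow> 'a mat" where
  "frontal_slice T k =
    mat (tensor_dim1 T) (tensor_dim2 T) (\<lambda>(i, j). tensor_entry T i j k)"

definition tube :: "'a tensor3 \<Rightarrow> nat \<Rightarrow> nat \<Rightarrow> 'a vec" where
  "tube T i j = vec (tensor_dim3 T) (\<lambda>k. tensor_entry T i j k)"

definition padding :: "nat \<Rightarrow> nat \<Rightarrow> nat" where
  "padding n2 h = (LEAST l. n2 dvd h + l)"

definition pad_cols :: "nat \<Rightarrow> 'a::zero mat \<Rightarrow> 'a mat" where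
  "pad_cols l X =
    four_block_mat X (0\<^sub>m (dim_row X) l) (0\<^sub>m 0 (dim_col X)) (0\<^sub>m 0 l)"

definition reshape :: "nat \<Rightarrow> 'a::zero mat \<Rightarrow> 'a tensor3" where
  "reshape n2 X =
    (let l = padding n2 (dim_col X);
         n3 = (dim_col X + l) div n2
     in Tensor3 (dim_row X) n2 n3 (\<lambda>i j k. pad_cols l X $$ (i, k * n2 + j)))"

definition dft_matrix :: "nat \<Rightarrow> complex mat" where
  "dft_matrix n =
    (let \<omega> = exp (- (2 * of_real pi * \<i>) / of_nat n)
     in mat n n (\<lambda>(a, b). \<omega> ^ (a * b)))"

definition tensor_dft :: "real tensor3 \<Rightarrow> complex tensor3" where
  "tensor_dft T =
    Tensor3 (tensor_dim1 T) (tensor_dim2 T) (tensor_dim3 T)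
      (\<lambda>i j k. (dft_matrix (tensor_dim3 T) *\<^sub>v map_vec complex_of_real (tube T i j)) $ k)"

definition multi_rank :: "real tensor3 \<Rightarrow> nat vec" where
  "multi_rank T = vec (tensor_dim3 T) (\<lambda>k. mat_rank (frontal_slice (tensor_dft T) k))"

definition tubal_rank :: "real tensor3 \<Rightarrow> nat" where
  "tubal_rank T = Max {multi_rank T $ k | k. k < tensor_dim3 T}"

definition l1_norm :: "real vec \<Rightarrow> real" where
  "l1_norm v = (\<Sum>i<dim_vec v. \<bar>v $ i\<bar>)"

end

(* Each frontal slice of the transformed tensor is the complexified X times a matrix, and the
   inverse DFT writes X as a sum over k of the k-th transformed slice times a matrix.  Since rank
   does not increase under right multiplication, is subadditive, and is unchanged when passing
   from the reals to the complex numbers, each slice has rank at most rank X, and rank X is at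
   most the sum of the ranks of the slices. *)

theory Submission
  imports Defs
begin

section \<open>Rank of matrix products and sums\<close>

text \<open>Each column of \<open>A * B\<close> is a linear combination of columns of
  \<open>A\<close>, so one column span lies inside the other, and dimension is monotone on
  subspaces.\<close>

lemma (in vec_space) rank_mult_left_le:
  assumes A: "A \<in> carrier_mat n m" and B: "B \<in> carrier_mat m p"
  shows "rank (A * B) \<le> rank A"
proof -
  let ?W = "span (set (cols A))"
  have cA: "set (cols A) \<subseteq> carrier_vec n"
    using A cols_dim by blast
  have sub: "submodule class_ring ?W V"
    using span_is_submodule cA by blast
  have vs: "vectorspace class_ring (vs ?W)"
    using span_is_subspace cA subspace_is_vs by blast
  have incl: "set (cols (A * B)) \<subseteq> ?W"
  proof
    fix v assume "v \<in> set (cols (A * B))"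
    then obtain j where j: "j < p" "v = col (A * B) j"
      using B by (auto simp: cols_def)
    have "v = A *\<^sub>v col B j"
      using col_mult2[OF A B] j by simp
    also have "A = mat_of_cols n (cols A)"
      using A by auto
    also have "mat_of_cols n (cols A) *\<^sub>v col B j = lincomb_list (\<lambda>i. col B j $ i) (cols A)"
    proof -
      have "vec m (\<lambda>i. col B j $ i) = col B j"
        using B j by (intro eq_vecI) auto
      then show ?thesis
        using lincomb_list_as_mat_mult[of "cols A" "\<lambda>i. col B j $ i"] cA A
        by (metis carrier_matD(2) carrier_vecD cols_length subsetD)
    qed
    also have "\<dots> \<in> span_list (cols A)"
      by (auto simp: span_list_def)
    also have "span_list (cols A) = ?W"
      using span_list_as_span cA by blast
    finally show "v \<in> ?W" .
  qed
  \<comment> \<open>Monotonicity of dimension is applied inside \<open>vs ?W\<close>;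
    \<open>span_li_not_depend\<close> identifies the span formed there with the ambient one.\<close>
  have "subspace class_ring (span (set (cols (A * B)))) (vs ?W)"
    using vectorspace.span_is_subspace[OF vs, of "set (cols (A * B))",
        unfolded span_li_not_depend(1)[OF incl sub]] incl by auto
  moreover have "vectorspace.fin_dim class_ring (vs ?W)"
    using fin_dim_span_cols A by blast
  moreover have "vectorspace.fin_dim class_ring (vs ?W\<lparr>carrier := span (set (cols (A * B)))\<rparr>)"
    using fin_dim_span_cols[of "A * B" p] A B by simp
  ultimately show ?thesis
    unfolding rank_def using vectorspace.subspace_dim[OF vs] by simp
qed

text \<open>Iterated subadditivity. Summing entries rather than matrices fixes the dimensions, so
  the empty sum is the zero matrix, of rank 0.\<close>

lemma (in vec_space) rank_sum_le:
  fixes N :: nat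
  shows "rank (mat n nc (\<lambda>ij. \<Sum>k<N. F k ij)) \<le> (\<Sum>k<N. rank (mat n nc (F k)))"
proof (induction N)
  case 0
  have "mat n nc (\<lambda>ij. \<Sum>k<0. F k ij) = (0\<^sub>m n nc :: 'a mat)"
    by (intro eq_matI) auto
  then show ?case using rank_0I[of nc] by simp
next
  case (Suc N)
  have "mat n nc (\<lambda>ij. \<Sum>k<Suc N. F k ij) = mat n nc (\<lambda>ij. \<Sum>k<N. F k ij) + mat n nc (F N)"
    by (intro eq_matI) auto
  with rank_subadditive[of "mat n nc (\<lambda>ij. \<Sum>k<N. F k ij)" nc "mat n nc (F N)"] Suc
  show ?case by simp
qed

section \<open>Invariance of rank under passing from the reals to the complex numbers\<close>

text \<open>A real dependency is also a complex one. Conversely, the real and imaginary parts of a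
  complex dependency between real vectors are real dependencies, and at least one of them is
  nontrivial.\<close>

lemma lin_dep_complex_of_real_iff:
  assumes S: "finite S" "S \<subseteq> carrier_vec n"
  shows "module.lin_dep class_ring (module_vec TYPE(complex) n) (map_vec complex_of_real ` S)
    \<longleftrightarrow> module.lin_dep class_ring (module_vec TYPE(real) n) S"
proof -
  interpret R: vec_space "TYPE(real)" n .
  interpret C: vec_space "TYPE(complex)" n .
  \<comment> \<open>Listing \<open>S\<close> as matrix columns turns dependence into a nonzero
    kernel vector. The list must be distinct: a repeated column gives such a vector even when the
    set is independent.\<close>
  obtain us where us: "set us = S" "distinct us"
    using finite_distinct_list S by blast
  let ?h = "map_vec complex_of_real"
  let ?m = "length us"
  define A where "A = mat_of_cols n us"
  define B where "B = map_mat complex_of_real A"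
  have A: "A \<in> carrier_mat n ?m" and B: "B \<in> carrier_mat n ?m"
    by (auto simp: A_def B_def)
  have cA: "cols A = us"
    using S us by (simp add: A_def)
  have cB: "cols B = map ?h us"
    by (simp add: B_def flip: cA) (simp add: cols_def)
  have inj: "inj_on ?h S"
    by (auto simp: inj_on_def vec_eq_iff)
  have dB: "distinct (cols B)"
    using us inj by (simp add: cB distinct_map)
  have sB: "set (cols B) = ?h ` S"
    using us cB by simp
  have kerB: "B *\<^sub>v ?h v = ?h (A *\<^sub>v v)" if "v \<in> carrier_vec ?m" for v
    using that A by (auto simp: B_def scalar_prod_def)
  show ?thesis
  proof
    assume "R.lin_dep S"
    then obtain v where v: "v \<in> carrier_vec ?m" "v \<noteq> 0\<^sub>v ?m" "A *\<^sub>v v = 0\<^sub>v n"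
      using R.lin_depE[OF A] us cA by metis
    have "B *\<^sub>v ?h v = 0\<^sub>v n"
      using kerB v by auto
    moreover have "?h v \<noteq> 0\<^sub>v ?m"
      using v by (auto simp: vec_eq_iff)
    ultimately show "C.lin_dep (?h ` S)"
      using C.lin_depI[OF B _ _ _ dB, of "?h v"] v sB by simp
  next
    assume "C.lin_dep (?h ` S)"
    then obtain v where v: "v \<in> carrier_vec ?m" "v \<noteq> 0\<^sub>v ?m" "B *\<^sub>v v = 0\<^sub>v n"
      using C.lin_depE[OF B _ dB] sB by metis
    have z: "(\<Sum>j = 0..<?m. complex_of_real (A $$ (i, j)) * v $ j) = 0" if "i < n" for i
    proof -
      have "(B *\<^sub>v v) $ i = 0"
        using v that by simp
      then show ?thesis
        using that v A by (simp add: B_def scalar_prod_def)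
    qed
    \<comment> \<open>The entries of \<open>A\<close> are real, so \<open>Re\<close> and
      \<open>Im\<close> pass through the sum in \<open>z\<close> onto the coefficients.\<close>
    have "A *\<^sub>v map_vec Re v = 0\<^sub>v n"
    proof (intro eq_vecI)
      fix i assume "i < dim_vec (0\<^sub>v n :: real vec)"
      then show "(A *\<^sub>v map_vec Re v) $ i = 0\<^sub>v n $ i"
        using arg_cong[OF z[of i], of Re] v A by (simp add: scalar_prod_def)
    qed (use A in auto)
    moreover have "A *\<^sub>v map_vec Im v = 0\<^sub>v n"
    proof (intro eq_vecI)
      fix i assume "i < dim_vec (0\<^sub>v n :: real vec)"
      then show "(A *\<^sub>v map_vec Im v) $ i = 0\<^sub>v n $ i"
        using arg_cong[OF z[of i], of Im] v A by (simp add: scalar_prod_def)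
    qed (use A in auto)
    moreover have "map_vec Re v \<noteq> 0\<^sub>v ?m \<or> map_vec Im v \<noteq> 0\<^sub>v ?m"
      using v by (auto simp: vec_eq_iff complex_eq_iff)
    ultimately show "R.lin_dep S"
      using R.lin_depI[OF A, of "map_vec Re v"] R.lin_depI[OF A, of "map_vec Im v"] v us cA
      by auto
  qed
qed

text \<open>Rank is the size of a maximal independent set of columns. The embedding is injective and
  respects independence both ways, so it carries such a set to one of the same size.\<close>

lemma rank_map_complex_of_real:
  assumes A: "A \<in> carrier_mat n nc"
  shows "vec_space.rank n (map_mat complex_of_real A) = vec_space.rank n A"
proof -
  interpret R: vec_space "TYPE(real)" n .
  interpret C: vec_space "TYPE(complex)" n .
  let ?h = "map_vec complex_of_real"
  let ?B = "map_mat complex_of_real A"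
  have B: "?B \<in> carrier_mat n nc" using A by simp
  have sB: "set (cols ?B) = ?h ` set (cols A)"
    by (force simp: cols_def)
  have cA: "set (cols A) \<subseteq> carrier_vec n"
    using A cols_dim by blast
  have inj: "inj_on ?h T" for T
    by (auto simp: inj_on_def vec_eq_iff)
  have iff: "C.lin_dep (?h ` T) \<longleftrightarrow> R.lin_dep T" if "T \<subseteq> set (cols A)" for T
    using that cA by (intro lin_dep_complex_of_real_iff) (auto intro: finite_subset)
  obtain S where S: "maximal S (\<lambda>T. T \<subseteq> set (cols A) \<and> R.lin_indpt T)"
    using maximal_exists_superset[of "set (cols A)" "\<lambda>T. T \<subseteq> set (cols A) \<and> R.lin_indpt T" "{}"]
      R.finite_lin_indpt2[of "{}"] by auto
  have "maximal (?h ` S) (\<lambda>T. T \<subseteq> set (cols ?B) \<and> C.lin_indpt T)"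
    unfolding maximal_def
  proof (intro conjI allI impI)
    show "?h ` S \<subseteq> set (cols ?B)" "C.lin_indpt (?h ` S)"
      using S iff[of S] by (auto simp: sB maximal_def)
  next
    \<comment> \<open>Any competing set consists of embedded columns, hence is the image of some
      \<open>T\<close>, and the maximality of \<open>S\<close> applies to \<open>T\<close>.\<close>
    fix T' assume *: "?h ` S \<subseteq> T' \<and> T' \<subseteq> set (cols ?B) \<and> C.lin_indpt T'"
    then obtain T where T: "T \<subseteq> set (cols A)" "T' = ?h ` T"
      unfolding sB by (meson subset_imageE)
    have "S \<subseteq> T"
      using * T inj_on_image_mem_iff[OF inj[of UNIV]] by blast
    moreover have "R.lin_indpt T"
      using iff[OF T(1)] * T by simp
    ultimately have "T = S"
      using S T unfolding maximal_def by blast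
    then show "T' = ?h ` S" using T by simp
  qed
  then have "C.rank ?B = card (?h ` S)"
    using C.rank_card_indpt[OF B] by blast
  also have "\<dots> = R.rank A"
    using card_image[OF inj] R.rank_card_indpt[OF A S] by simp
  finally show ?thesis .
qed

section \<open>Orthogonality of the roots of unity\<close>

text \<open>For \<open>l \<noteq> m\<close> this is a geometric sum whose ratio is an
  \<open>N\<close>-th root of unity other than 1, so it vanishes; for \<open>l = m\<close> every
  term is 1.\<close>

lemma sum_root_unity_orthogonal:
  fixes N l m :: nat
  assumes "l < N" "m < N"
  defines "w \<equiv> exp (- (2 * of_real pi * \<i>) / of_nat N) :: complex"
  shows "(\<Sum>k<N. inverse w ^ (k * l) * w ^ (k * m)) = (if l = m then of_nat N else 0)"
proof (cases "l = m")
  case True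
  have "inverse w ^ (k * l) * w ^ (k * l) = 1" for k
    by (simp add: w_def flip: power_mult_distrib)
  then show ?thesis using True by simp
next
  case False
  have N: "N > 0" using assms by simp
  \<comment> \<open>\<open>q\<close> is \<open>w\<close> to the power \<open>m - l\<close>, written
    so that the exponents stay natural.\<close>
  define q where "q = inverse w ^ l * w ^ m"
  have wN: "w ^ N = 1"
    unfolding w_def exp_of_nat_mult[symmetric] using N by (simp add: exp_minus)
  have "q ^ N = inverse (w ^ N) ^ l * (w ^ N) ^ m"
    by (simp add: q_def power_mult_distrib power_inverse mult.commute flip: power_mult)
  then have qN: "q ^ N = 1" by (simp add: wN)
  have "q \<noteq> 1"
  proof
    assume "q = 1"
    have "w ^ k = cis (- (2 * pi * real k / real N))" for k
      by (simp add: w_def cis_conv_exp mult_ac flip: exp_of_nat_mult)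
    \<comment> \<open>Conjugation reverses the negative angle of \<open>w\<close>, giving the
      parametrization whose injectivity below \<open>N\<close> comes from
      \<open>bij_betw_roots_unity\<close>.\<close>
    then have cnj_w: "cnj (w ^ k) = cis (2 * pi * real k / real N)" for k
      by (simp add: cis_cnj)
    have "w ^ l = w ^ m"
      using \<open>q = 1\<close> by (simp add: q_def w_def power_inverse field_simps)
    then have "cis (2 * pi * real l / real N) = cis (2 * pi * real m / real N)"
      by (simp flip: cnj_w)
    then show False
      using bij_betw_imp_inj_on[OF bij_betw_roots_unity[OF N]] False assms
      by (auto dest: inj_onD)
  qed
  have "(\<Sum>k<N. inverse w ^ (k * l) * w ^ (k * m)) = (\<Sum>k<N. q ^ k)"
    by (simp add: q_def power_mult_distrib mult.commute flip: power_mult)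
  also have "\<dots> = 0"
    using \<open>q \<noteq> 1\<close> qN by (simp add: sum_gp_strict)
  finally show ?thesis using False by simp
qed


section \<open>Arithmetic of padding and column blocks\<close>

lemma dvd_add_padding: "0 < n \<Longrightarrow> n dvd h + padding n h"
  \<comment> \<open>The witness works because \<open>h + (n - 1) * h = n * h\<close>.\<close>
  unfolding padding_def by (rule LeastI[of _ "(n - 1) * h"]) (simp add: algebra_simps flip: mult_Suc)

text \<open>Column \<open>c\<close> of the matrix is column \<open>c mod n2\<close> of block
  \<open>c div n2\<close>. Fixing the residue leaves the block number as summation index; the guard
  discards padded columns.\<close>

lemma reshape_sum_fibre:
  fixes f :: "nat \<Rightarrow> 'a::comm_monoid_add"
  assumes "j < n2" "h \<le> n3 * n2"
  shows "(\<Sum>c<h. if c mod n2 = j then f c else 0) =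
    (\<Sum>l<n3. if l * n2 + j < h then f (l * n2 + j) else 0)"
proof -
  have "(\<Sum>c<h. if c mod n2 = j then f c else 0) = (\<Sum>c | c < h \<and> c mod n2 = j. f c)"
    by (intro sum.mono_neutral_cong_right) auto
  also have "\<dots> = (\<Sum>l | l < n3 \<and> l * n2 + j < h. f (l * n2 + j))"
  proof (rule sum.reindex_bij_witness[of _ "\<lambda>l. l * n2 + j" "\<lambda>c. c div n2"])
    fix c assume "c \<in> {c. c < h \<and> c mod n2 = j}"
    then show "c div n2 * n2 + j = c" "f (c div n2 * n2 + j) = f c"
      "c div n2 \<in> {l. l < n3 \<and> l * n2 + j < h}"
      using assms by (auto simp: less_mult_imp_div_less)
  qed (use assms in auto)
  also have "\<dots> = (\<Sum>l<n3. if l * n2 + j < h then f (l * n2 + j) else 0)"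
    by (intro sum.mono_neutral_cong_left) auto
  finally show ?thesis .
qed

section \<open>Slices of the transformed tensor and the inverse DFT\<close>

context
  fixes X :: "real mat" and n1 n2 n3 h :: nat
  assumes X: "X \<in> carrier_mat n1 h"
    and n2: "0 < n2"
    and n3: "n3 = tensor_dim3 (reshape n2 X)"
begin

private definition w :: complex where
  "w = exp (- (2 * of_real pi * \<i>) / of_nat n3)"

private definition slice :: "nat \<Rightarrow> complex mat" where
  "slice k = frontal_slice (tensor_dft (reshape n2 X)) k"

private lemma n3_mult_n2: "n3 * n2 = h + padding n2 h"
  using X n3 dvd_add_padding[OF n2, of h] by (simp add: reshape_def Let_def)

private lemma h_le: "h \<le> n3 * n2"
  using n3_mult_n2 by simp

private lemma slice_carrier: "slice k \<in> carrier_mat n1 n2"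
  using X by (auto simp: slice_def frontal_slice_def tensor_dft_def reshape_def Let_def)

private lemma slice_entry:
  assumes i: "i < n1" and j: "j < n2" and k: "k < n3"
  shows "slice k $$ (i, j) = (\<Sum>l<n3. w ^ (k * l) *
    (if l * n2 + j < h then complex_of_real (X $$ (i, l * n2 + j)) else 0))"
proof -
  let ?T = "reshape n2 X"
  have entry: "tensor_entry ?T i j l =
      (if l * n2 + j < h then X $$ (i, l * n2 + j) else 0)" if "l < n3" for l
  proof -
    \<comment> \<open>The position lies within the padded matrix, where \<open>pad_cols\<close> has
      either an entry of \<open>X\<close> or a padding zero.\<close>
    have "l * n2 + j < Suc l * n2" using j by simp
    also have "\<dots> \<le> n3 * n2" using that by (intro mult_le_mono1) simp
    finally have "l * n2 + j < h + padding n2 h" by (simp add: n3_mult_n2)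
    then show ?thesis
      using X i by (auto simp: reshape_def Let_def pad_cols_def)
  qed
  have "slice k $$ (i, j) = (dft_matrix n3 *\<^sub>v map_vec complex_of_real (tube ?T i j)) $ k"
    using X i j by (simp add: slice_def frontal_slice_def tensor_dft_def n3 reshape_def Let_def)
  also have "\<dots> = (\<Sum>l<n3. w ^ (k * l) * complex_of_real (tensor_entry ?T i j l))"
    using k by (simp add: dft_matrix_def w_def Let_def scalar_prod_def tube_def atLeast0LessThan
        flip: n3)
  also have "\<dots> = (\<Sum>l<n3. w ^ (k * l) *
    (if l * n2 + j < h then complex_of_real (X $$ (i, l * n2 + j)) else 0))"
    by (intro sum.cong) (auto simp: entry)
  finally show ?thesis .
qed

text \<open>The slice is the sum of the column blocks weighted by \<open>w ^ (k * l)\<close>. The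
  right factor stacks the matching multiples of the identity, cut to \<open>h\<close> rows because
  padded columns contribute nothing.\<close>

private lemma slice_eq_mult:
  assumes k: "k < n3"
  shows "slice k = map_mat complex_of_real X *
    mat h n2 (\<lambda>(c, j). if c mod n2 = j then w ^ (k * (c div n2)) else 0)" (is "_ = _ * ?W")
proof (rule eq_matI)
  fix i j assume "i < dim_row (map_mat complex_of_real X * ?W)"
    "j < dim_col (map_mat complex_of_real X * ?W)"
  then have i: "i < n1" and j: "j < n2" using X by auto
  have "(map_mat complex_of_real X * ?W) $$ (i, j) =
    (\<Sum>c<h. if c mod n2 = j then complex_of_real (X $$ (i, c)) * w ^ (k * (c div n2)) else 0)"
    using X i j by (auto simp: scalar_prod_def atLeast0LessThan intro!: sum.cong)
  also have "\<dots> = (\<Sum>l<n3. if l * n2 + j < h then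
      complex_of_real (X $$ (i, l * n2 + j)) * w ^ (k * ((l * n2 + j) div n2)) else 0)"
    by (rule reshape_sum_fibre[OF j h_le])
  also have "\<dots> = slice k $$ (i, j)"
    unfolding slice_entry[OF i j k] using j by (intro sum.cong) auto
  finally show "slice k $$ (i, j) = (map_mat complex_of_real X * ?W) $$ (i, j)" by simp
qed (use X slice_carrier[of k] in auto)

text \<open>The share of slice \<open>k\<close> in the inverse DFT: a row of identity blocks, the
  \<open>m\<close>-th scaled by \<open>inverse w ^ (k * m) / n3\<close>, cut to \<open>h\<close>
  columns so that the padding is dropped again.\<close>

private definition inv_coeff :: "nat \<Rightarrow> complex mat" where
  "inv_coeff k = mat n2 h
    (\<lambda>(j, c). if j = c mod n2 then inverse w ^ (k * (c div n2)) / of_nat n3 else 0)"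

private lemma slice_mult_inv_coeff:
  assumes i: "i < n1" and c: "c < h"
  shows "(slice k * inv_coeff k) $$ (i, c) =
    slice k $$ (i, c mod n2) * inverse w ^ (k * (c div n2)) / of_nat n3"
proof -
  have "(slice k * inv_coeff k) $$ (i, c) =
    (\<Sum>j<n2. if j = c mod n2 then slice k $$ (i, j) * inverse w ^ (k * (c div n2)) / of_nat n3
       else 0)"
    using i c slice_carrier[of k]
    by (auto simp: scalar_prod_def inv_coeff_def atLeast0LessThan simp del: sum.delta
        intro!: sum.cong)
  then show ?thesis using n2 by simp
qed

text \<open>After exchanging the sums over \<open>k\<close> and \<open>l\<close>, orthogonality
  keeps only the block \<open>l = m\<close> containing the column \<open>c\<close>.\<close>

private lemma inverse_dft:
  "map_mat complex_of_real X = mat n1 h (\<lambda>ij. \<Sum>k<n3. (slice k * inv_coeff k) $$ ij)"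
proof (rule eq_matI)
  let ?M = "mat n1 h (\<lambda>ij. \<Sum>k<n3. (slice k * inv_coeff k) $$ ij)"
  fix i c assume "i < dim_row ?M" "c < dim_col ?M"
  then have i: "i < n1" and c: "c < h" by auto
  define m j where "m = c div n2" and "j = c mod n2"
  have j: "j < n2" and mj: "m * n2 + j = c" using n2 by (auto simp: m_def j_def)
  have m: "m < n3"
    using c h_le by (auto simp: m_def less_mult_imp_div_less)
  \<comment> \<open>\<open>x\<close> is the complexified tube at \<open>(i, j)\<close>, with zeros
    at padded positions.\<close>
  define x where "x l = (if l * n2 + j < h then complex_of_real (X $$ (i, l * n2 + j)) else 0)" for l
  have "?M $$ (i, c) = (\<Sum>k<n3. (\<Sum>l<n3. w ^ (k * l) * x l) * inverse w ^ (k * m) / of_nat n3)"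
    using i c by (auto simp: slice_mult_inv_coeff slice_entry[OF i j, folded x_def]
        simp flip: m_def j_def intro!: sum.cong)
  also have "\<dots> = (\<Sum>k<n3. \<Sum>l<n3. inverse w ^ (k * m) * w ^ (k * l) * (x l / of_nat n3))"
    by (simp add: sum_distrib_right sum_distrib_left sum_divide_distrib mult_ac)
  also have "\<dots> = (\<Sum>l<n3. \<Sum>k<n3. inverse w ^ (k * m) * w ^ (k * l) * (x l / of_nat n3))"
    by (rule sum.swap)
  also have "\<dots> = (\<Sum>l<n3. (if m = l then of_nat n3 else 0) * (x l / of_nat n3))"
    using sum_root_unity_orthogonal[OF m, folded w_def]
    by (intro sum.cong) (simp_all flip: sum_distrib_right sum_divide_distrib)
  also have "\<dots> = (\<Sum>l<n3. if l = m then x m else 0)"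
    using m by (intro sum.cong) auto
  \<comment> \<open>The guard in \<open>x m\<close> holds since \<open>m * n2 + j = c\<close> and
    \<open>c < h\<close>.\<close>
  also have "\<dots> = complex_of_real (X $$ (i, c))"
    using m c by (simp add: x_def mj)
  finally show "map_mat complex_of_real X $$ (i, c) = ?M $$ (i, c)"
    using X i c by simp
qed (use X in auto)

private lemma rank_eq: "mat_rank X = vec_space.rank n1 (map_mat complex_of_real X)"
  using X by (simp add: mat_rank_def rank_map_complex_of_real)

private lemma rank_slice: "mat_rank (slice k) = vec_space.rank n1 (slice k)"
  using slice_carrier[of k] by (simp add: mat_rank_def)

section \<open>Rank inequalities between the matrix and the slices\<close>

lemma rank_dft_slice_le:
  "k < n3 \<Longrightarrow> mat_rank (frontal_slice (tensor_dft (reshape n2 X)) k) \<le> mat_rank X"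
  unfolding slice_def[symmetric] rank_slice rank_eq using X
  by (subst slice_eq_mult) (auto intro!: vec_space.rank_mult_left_le)

lemma rank_le_sum_dft_slice:
  "mat_rank X \<le> (\<Sum>k<n3. mat_rank (frontal_slice (tensor_dft (reshape n2 X)) k))"
proof -
  have V: "inv_coeff k \<in> carrier_mat n2 h" for k
    by (simp add: inv_coeff_def)
  have "mat_rank X \<le> (\<Sum>k<n3. vec_space.rank n1 (mat n1 h (\<lambda>ij. (slice k * inv_coeff k) $$ ij)))"
    unfolding rank_eq inverse_dft by (rule vec_space.rank_sum_le)
  also have "\<dots> = (\<Sum>k<n3. vec_space.rank n1 (slice k * inv_coeff k))"
  \<comment> \<open>\<open>rank_sum_le\<close> yields matrices rebuilt from their entries; these are
    the products themselves.\<close>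
  proof (rule sum.cong)
    fix k
    have "slice k * inv_coeff k \<in> carrier_mat n1 h"
      using slice_carrier V by (rule mult_carrier_mat)
    then have "mat n1 h (\<lambda>ij. (slice k * inv_coeff k) $$ ij) = slice k * inv_coeff k"
      by (intro eq_matI) (auto simp: carrier_matD simp del: index_mult_mat)
    then show "vec_space.rank n1 (mat n1 h (\<lambda>ij. (slice k * inv_coeff k) $$ ij)) =
      vec_space.rank n1 (slice k * inv_coeff k)" by simp
  qed simp
  also have "\<dots> \<le> (\<Sum>k<n3. mat_rank (slice k))"
    unfolding rank_slice
    by (intro sum_mono vec_space.rank_mult_left_le[OF slice_carrier V])
  finally show ?thesis by (simp add: slice_def)
qed

text \<open>Ensures that the maximum defining the tubal rank is over a nonempty set.\<close>

lemma tensor_dim3_reshape_pos: "0 < h \<Longrightarrow> 0 < n3"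
  using n3_mult_n2 by (cases n3) auto

end

theorem mainTheorem2:
  fixes X :: "real mat" and T :: "real tensor3" and n1 n2 n3 h :: nat
  assumes "X \<in> carrier_mat n1 h"
    and "0 < h" and "0 < n2"
    and "T = reshape n2 X"
    and "n3 = tensor_dim3 T"
  shows "tubal_rank T \<le> mat_rank X \<and>
    mat_rank X \<le> n3 * tubal_rank T \<and>
    real (mat_rank X) \<le> l1_norm (map_vec real (multi_rank T)) \<and>
    l1_norm (map_vec real (multi_rank T)) \<le> real (n3 * mat_rank X)"
proof -
  define r where "r k = mat_rank (frontal_slice (tensor_dft T) k)" for k
  have n3: "n3 = tensor_dim3 (reshape n2 X)"
    using assms by simp
  have pos: "0 < n3"
    using tensor_dim3_reshape_pos[OF assms(1,3) n3] assms by simp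
  \<comment> \<open>All four inequalities follow from \<open>upper\<close> and \<open>lower\<close>,
    by comparing the sum of the \<open>r k\<close> with \<open>n3\<close> times a common upper
    bound.\<close>
  have upper: "r k \<le> mat_rank X" if "k < n3" for k
    using rank_dft_slice_le[OF assms(1,3) n3 that] assms by (simp add: r_def)
  have lower: "mat_rank X \<le> (\<Sum>k<n3. r k)"
    using rank_le_sum_dft_slice[OF assms(1,3) n3] assms by (simp add: r_def)
  have multi: "multi_rank T $ k = r k" if "k < n3" for k
    using that by (simp add: multi_rank_def r_def assms(5))
  have "{multi_rank T $ k | k. k < n3} = r ` {..<n3}"
    using multi by force
  then have tubal: "tubal_rank T = Max (r ` {..<n3})"
    by (simp add: tubal_rank_def flip: assms(5))
  have l1: "l1_norm (map_vec real (multi_rank T)) = real (\<Sum>k<n3. r k)"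
    by (simp add: l1_norm_def multi_rank_def r_def assms(5))
  have "tubal_rank T \<le> mat_rank X"
    unfolding tubal using upper pos by (subst Max_le_iff) auto
  moreover have "(\<Sum>k<n3. r k) \<le> n3 * tubal_rank T"
    using sum_bounded_above[of "{..<n3}" r "tubal_rank T"] by (simp add: tubal)
  moreover have "(\<Sum>k<n3. r k) \<le> n3 * mat_rank X"
    using sum_bounded_above[of "{..<n3}" r "mat_rank X"] upper by simp
  ultimately show ?thesis
    using lower unfolding l1 by (auto simp flip: of_nat_mult simp del: of_nat_sum)
qed

end
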